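(* The adjacency matroid and the principal vertex tripartition are independent, in the following sense: there exist two graphs with isomorphic adjacency matroids and distinct (inequivalent) principal vertex tripartitions, and there exist two graphs with nonisomorphic adjacency matroids and equivalent principal vertex tripartitions.
   Context: Graphs are finite and may have loops and parallel edges. $\mathcal{A}(G)$ is the symmetric $V(G)\times V(G)$ matrix over $GF(2)$ with $a_{vv}=1$ iff $v$ is looped and, for $v\ne w$, $a_{vw}=1$ iff $v,w$ are adjacent. The adjacency matroid $M_A(G)$ is the binary matroid on $V(G)$ whose circuits are the minimal nonempty $S\subseteq V(G)$ such that the columns of $\mathcal{A}(G)$ indexed by $S$ are linearly dependent over $GF(2)$. An element is a coloop of a matroid if it belongs to no circuit. For $v\in V(G)$, $G(v)$ is the graph obtained from $G$ by removing every loop at $v$, and $G(v,\ell)$ is obtained from $G(v)$ by attaching a loop at $v$. Each vertex $v$ is a coloop of at least one of $M_A(G(v))$, $M_A(G(v,\ell))$, so it falls under exactly one of the cases: (1) $v$ is a coloop of both $M_A(G(v))$ and $M_A(G(v,\ell))$; (2) $v$ is a coloop of $M_A(G(v))$ and not of $M_A(G(v,\ell))$; (3) $v$ is a coloop of $M_A(G(v,\ell))$ and not of $M_A(G(v))$. The resulting partition of $V(G)$ into three (possibly empty) labelled classes is the principal vertex tripartition of $G$. The principal vertex tripartitions of $G$ and $G'$ are equivalent if there is a bijection $V(G)\to V(G')$ sending the class of case $i$ for $G$ onto the class of case $i$ for $G'$, for $i=1,2,3$; otherwise they are distinct. *)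

theory Defs
  imports "HOL-Library.Multiset" "HOL-Library.Uprod" "HOL-Library.Z2"
begin

text \<open>
  Edges are unordered pairs of end-vertices, counted with multiplicity: \<open>Upair v v\<close>
  is a loop at \<open>v\<close>, and parallel edges are repeated elements of the multiset.
\<close>

record 'v graph =
  verts :: "'v set"
  edges :: "'v uprod multiset"

definition wf_graph :: "'v graph \<Rightarrow> bool" where
  "wf_graph G \<longleftrightarrow> finite (verts G) \<and> (\<forall>e \<in># edges G. set_uprod e \<subseteq> verts G)"

definition looped :: "'v graph \<Rightarrow> 'v \<Rightarrow> bool" where
  "looped G v \<longleftrightarrow> Upair v v \<in># edges G"

definition adjacent :: "'v graph \<Rightarrow> 'v \<Rightarrow> 'v \<Rightarrow> bool" where
  "adjacent G v w \<longleftrightarrow> v \<noteq> w \<and> Upair v w \<in># edges G"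

definition remove_loops :: "'v graph \<Rightarrow> 'v \<Rightarrow> 'v graph" where
  "remove_loops G v = G\<lparr>edges := filter_mset (\<lambda>e. e \<noteq> Upair v v) (edges G)\<rparr>"

definition with_loop :: "'v graph \<Rightarrow> 'v \<Rightarrow> 'v graph" where
  "with_loop G v = remove_loops G v\<lparr>edges := add_mset (Upair v v) (edges (remove_loops G v))\<rparr>"

record 'v matroid =
  ground :: "'v set"
  circuits :: "'v set set"

definition is_matroid :: "'v matroid \<Rightarrow> bool" where
  "is_matroid M \<longleftrightarrow>
     finite (ground M) \<and> circuits M \<subseteq> Pow (ground M) \<and> {} \<notin> circuits M \<and>
     (\<forall>C \<in> circuits M. \<forall>D \<in> circuits M. C \<subseteq> D \<longrightarrow> C = D) \<and>
     (\<forall>C \<in> circuits M. \<forall>D \<in> circuits M. \<forall>x \<in> C \<inter> D. C \<noteq> D \<longrightarrow>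
        (\<exists>E \<in> circuits M. E \<subseteq> (C \<union> D) - {x}))"

definition coloop :: "'v matroid \<Rightarrow> 'v \<Rightarrow> bool" where
  "coloop M v \<longleftrightarrow> v \<in> ground M \<and> (\<forall>C \<in> circuits M. v \<notin> C)"

definition matroid_isomorphic :: "'v matroid \<Rightarrow> 'w matroid \<Rightarrow> bool" where
  "matroid_isomorphic M N \<longleftrightarrow>
     (\<exists>f. bij_betw f (ground M) (ground N) \<and>
          (\<forall>S. S \<subseteq> ground M \<longrightarrow> (S \<in> circuits M \<longleftrightarrow> f ` S \<in> circuits N)))"

text \<open>
  The type \<^typ>\<open>bit\<close> is the field with two elements.  The matrix is only meaningful
  at indices in \<open>verts G\<close>.
\<close>

definition adj_matrix :: "'v graph \<Rightarrow> 'v \<Rightarrow> 'v \<Rightarrow> bit" where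
  "adj_matrix G v w = (if v = w then of_bool (looped G v) else of_bool (adjacent G v w))"

text \<open>
  Dependence of the columns is that of an indexed family, so that two equal columns
  with distinct indices are dependent.
\<close>

definition columns_dependent :: "'v graph \<Rightarrow> 'v set \<Rightarrow> bool" where
  "columns_dependent G S \<longleftrightarrow>
     (\<exists>c :: 'v \<Rightarrow> bit. (\<exists>s \<in> S. c s \<noteq> 0) \<and>
        (\<forall>w \<in> verts G. (\<Sum>s\<in>S. c s * adj_matrix G w s) = 0))"

definition adjacency_matroid :: "'v graph \<Rightarrow> 'v matroid" where
  "adjacency_matroid G = \<lparr>
     ground = verts G,
     circuits = {S. S \<subseteq> verts G \<and> S \<noteq> {} \<and> columns_dependent G S \<and>
       (\<forall>T. T \<subset> S \<and> T \<noteq> {} \<longrightarrow> \<not> columns_dependent G T)}\<rparr>"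

datatype vertex_case = Coloop_both | Coloop_unlooped_only | Coloop_looped_only

fun vertex_class :: "'v graph \<Rightarrow> vertex_case \<Rightarrow> 'v set" where
  "vertex_class G Coloop_both =
     {v \<in> verts G. coloop (adjacency_matroid (remove_loops G v)) v \<and>
                   coloop (adjacency_matroid (with_loop G v)) v}"
| "vertex_class G Coloop_unlooped_only =
     {v \<in> verts G. coloop (adjacency_matroid (remove_loops G v)) v \<and>
                   \<not> coloop (adjacency_matroid (with_loop G v)) v}"
| "vertex_class G Coloop_looped_only =
     {v \<in> verts G. coloop (adjacency_matroid (with_loop G v)) v \<and>
                   \<not> coloop (adjacency_matroid (remove_loops G v)) v}"

definition tripartition_equivalent :: "'v graph \<Rightarrow> 'w graph \<Rightarrow> bool" where
  "tripartition_equivalent G H \<longleftrightarrow>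
     (\<exists>f. bij_betw f (verts G) (verts H) \<and>
          (\<forall>i. f ` vertex_class G i = vertex_class H i))"

lemma adj_matrix_sym: "adj_matrix G v w = adj_matrix G w v"
proof -
  have swap: "Upair v w = Upair w v" by simp
  have "adjacent G v w = adjacent G w v"
    unfolding adjacent_def by (subst swap) auto
  then show ?thesis by (auto simp: adj_matrix_def)
qed

lemma columns_dependent_iff:
  assumes "finite S"
  shows "columns_dependent G S \<longleftrightarrow>
    (\<exists>T \<subseteq> S. T \<noteq> {} \<and> (\<forall>w \<in> verts G. (\<Sum>s\<in>T. adj_matrix G w s) = 0))"
proof
  assume "columns_dependent G S"
  then obtain c where c: "\<exists>s \<in> S. c s \<noteq> 0"
    "\<forall>w \<in> verts G. (\<Sum>s\<in>S. c s * adj_matrix G w s) = 0"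
    unfolding columns_dependent_def by blast
  let ?T = "{s \<in> S. c s \<noteq> 0}"
  have "(\<Sum>s\<in>?T. adj_matrix G w s) = (\<Sum>s\<in>S. c s * adj_matrix G w s)" for w
  proof (rule sum.mono_neutral_cong_left[OF assms])
    show "adj_matrix G w s = c s * adj_matrix G w s" if "s \<in> ?T" for s
      using that by (cases "c s") auto
  qed auto
  then show "\<exists>T \<subseteq> S. T \<noteq> {} \<and> (\<forall>w \<in> verts G. (\<Sum>s\<in>T. adj_matrix G w s) = 0)"
    using c by (intro exI[of _ ?T]) auto
next
  assume "\<exists>T \<subseteq> S. T \<noteq> {} \<and> (\<forall>w \<in> verts G. (\<Sum>s\<in>T. adj_matrix G w s) = 0)"
  then obtain T where T: "T \<subseteq> S" "T \<noteq> {}" "\<forall>w \<in> verts G. (\<Sum>s\<in>T. adj_matrix G w s) = 0"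
    by blast
  have "(\<Sum>s\<in>S. of_bool (s \<in> T) * adj_matrix G w s) = (\<Sum>s\<in>T. adj_matrix G w s)" for w
    by (rule sum.mono_neutral_cong_right[OF assms T(1)]) auto
  then show "columns_dependent G S"
    unfolding columns_dependent_def using T by (intro exI[of _ "\<lambda>s. of_bool (s \<in> T)"]) auto
qed

lemma circuit_columns_sum:
  assumes "finite (verts G)" "C \<in> circuits (adjacency_matroid G)" "w \<in> verts G"
  shows "(\<Sum>s\<in>C. adj_matrix G w s) = 0"
proof -
  have C: "C \<subseteq> verts G" "columns_dependent G C"
    "\<And>T. T \<subset> C \<Longrightarrow> T \<noteq> {} \<Longrightarrow> \<not> columns_dependent G T"
    using assms(2) by (auto simp: adjacency_matroid_def)
  have fin: "finite C" using C(1) assms(1) by (rule finite_subset)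
  obtain T where T: "T \<subseteq> C" "T \<noteq> {}" "\<forall>w \<in> verts G. (\<Sum>s\<in>T. adj_matrix G w s) = 0"
    using C(2) columns_dependent_iff[OF fin] by blast
  have "columns_dependent G T"
    using columns_dependent_iff[of T] T finite_subset[OF T(1) fin] by blast
  then have "T = C" using C(3) T by blast
  then show ?thesis using T(3) assms(3) by blast
qed

lemma dependent_contains_circuit:
  assumes "finite (verts G)" "S \<subseteq> verts G" "S \<noteq> {}" "columns_dependent G S"
  shows "\<exists>C \<in> circuits (adjacency_matroid G). C \<subseteq> S"
proof -
  have "finite S" using assms(1,2) finite_subset by blast
  then show ?thesis using assms(2-)
  proof (induction S rule: finite_psubset_induct)
    case (psubset S)
    show ?case
    proof (cases "\<exists>T. T \<subset> S \<and> T \<noteq> {} \<and> columns_dependent G T")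
      case True
      then obtain T where "T \<subset> S" "T \<noteq> {}" "columns_dependent G T" by blast
      then show ?thesis using psubset.IH[of T] psubset.prems(1) by blast
    next
      case False
      then have "S \<in> circuits (adjacency_matroid G)"
        using psubset.prems by (auto simp: adjacency_matroid_def)
      then show ?thesis by blast
    qed
  qed
qed

lemma is_matroid_adjacency_matroid:
  assumes "finite (verts G)"
  shows "is_matroid (adjacency_matroid G)"
proof -
  let ?M = "adjacency_matroid G"
  have elim: "\<exists>E \<in> circuits ?M. E \<subseteq> (C \<union> D) - {x}"
    if CD: "C \<in> circuits ?M" "D \<in> circuits ?M" "x \<in> C \<inter> D" "C \<noteq> D" for C D x
  proof -
    let ?S = "(C - D) \<union> (D - C)"
    have sub: "C \<subseteq> verts G" "D \<subseteq> verts G" using CD by (auto simp: adjacency_matroid_def)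
    then have fin: "finite C" "finite D" using assms finite_subset by blast+
    have "(\<Sum>s\<in>?S. adj_matrix G w s) = 0" if w: "w \<in> verts G" for w
    proof -
      let ?f = "adj_matrix G w"
      have "sum ?f C = sum ?f (C - D) + sum ?f (C \<inter> D)"
        using sum.Int_Diff[OF fin(1), of ?f D] by (metis add.commute)
      moreover have "sum ?f D = sum ?f (D - C) + sum ?f (C \<inter> D)"
        using sum.Int_Diff[OF fin(2), of ?f C] by (metis add.commute Int_commute)
      moreover have "sum ?f ?S = sum ?f (C - D) + sum ?f (D - C)"
        using fin by (intro sum.union_disjoint) auto
      ultimately show ?thesis
        using circuit_columns_sum[OF assms CD(1) w] circuit_columns_sum[OF assms CD(2) w]
        by (cases "sum ?f (C \<inter> D)"; cases "sum ?f (C - D)"; cases "sum ?f (D - C)") auto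
    qed
    moreover have ne: "?S \<noteq> {}" using CD(4) by blast
    ultimately have "columns_dependent G ?S"
      using columns_dependent_iff[of ?S G] fin by blast
    then obtain E where "E \<in> circuits ?M" "E \<subseteq> ?S"
      using dependent_contains_circuit[OF assms _ ne] sub by blast
    then show ?thesis using CD(3) by blast
  qed
  have anti: "C = D" if "C \<in> circuits ?M" "D \<in> circuits ?M" "C \<subseteq> D" for C D
  proof (rule ccontr)
    assume "C \<noteq> D"
    then have "C \<subset> D" using that(3) by blast
    moreover have "C \<noteq> {}" "columns_dependent G C"
      using that(1) by (simp_all add: adjacency_matroid_def)
    moreover have "\<forall>T. T \<subset> D \<and> T \<noteq> {} \<longrightarrow> \<not> columns_dependent G T"
      using that(2) by (simp add: adjacency_matroid_def)
    ultimately show False by blast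
  qed
  have basic: "finite (ground ?M)" "circuits ?M \<subseteq> Pow (ground ?M)" "{} \<notin> circuits ?M"
    using assms by (auto simp: adjacency_matroid_def)
  show ?thesis
    unfolding is_matroid_def
    by (intro conjI ballI impI basic) (erule (2) anti, erule (3) elim)
qed

lemma loop_variants_simps:
  "verts (remove_loops G v) = verts G"
  "verts (with_loop G v) = verts G"
  "adj_matrix (remove_loops G v) x y =
     (if x = v \<and> y = v then 0 else adj_matrix G x y)"
  "adj_matrix (with_loop G v) x y =
     (if x = v \<and> y = v then 1 else adj_matrix G x y)"
  by (auto simp: remove_loops_def with_loop_def adj_matrix_def looped_def adjacent_def)

lemma coloop_remove_loops_or_with_loop:
  assumes fin: "finite (verts G)" and v: "v \<in> verts G"
  shows "coloop (adjacency_matroid (remove_loops G v)) v \<or>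
         coloop (adjacency_matroid (with_loop G v)) v"
proof (rule ccontr)
  assume "\<not> ?thesis"
  then obtain C D where
    C: "C \<in> circuits (adjacency_matroid (remove_loops G v))" "v \<in> C" and
    D: "D \<in> circuits (adjacency_matroid (with_loop G v))" "v \<in> D"
    using v by (auto simp: coloop_def adjacency_matroid_def loop_variants_simps)
  let ?A = "adj_matrix (remove_loops G v)" and ?B = "adj_matrix (with_loop G v)"
  have sub: "C \<subseteq> verts G" "D \<subseteq> verts G"
    using C D by (auto simp: adjacency_matroid_def loop_variants_simps)
  then have finCD: "finite C" "finite D" using fin finite_subset by blast+
  have sC: "(\<Sum>s\<in>C. ?A w s) = 0" if "w \<in> verts G" for w
    using circuit_columns_sum[OF _ C(1)] fin that by (simp add: loop_variants_simps)
  have sD: "(\<Sum>s\<in>D. ?B w s) = 0" if "w \<in> verts G" for w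
    using circuit_columns_sum[OF _ D(1)] fin that by (simp add: loop_variants_simps)
  have B: "?B x y = ?A x y + of_bool (x = v \<and> y = v)" for x y
    by (auto simp: loop_variants_simps)
  have "(\<Sum>w\<in>C. \<Sum>s\<in>D. ?B w s) = 0" using sD sub by (intro sum.neutral) auto
  then have "0 = (\<Sum>w\<in>C. \<Sum>s\<in>D. ?B w s)" by simp
  also have "\<dots> = (\<Sum>w\<in>C. \<Sum>s\<in>D. ?A w s) + (\<Sum>w\<in>C. \<Sum>s\<in>D. of_bool (w = v \<and> s = v))"
    by (simp only: B sum.distrib)
  also have "(\<Sum>w\<in>C. \<Sum>s\<in>D. ?A w s) = (\<Sum>s\<in>D. \<Sum>w\<in>C. ?A s w)"
    by (subst sum.swap) (simp add: adj_matrix_sym[of "remove_loops G v"])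
  also have "\<dots> = 0" using sC sub by (auto intro: sum.neutral)
  also have "(\<Sum>w\<in>C. \<Sum>s\<in>D. of_bool (w = v \<and> s = v) :: bit) = 1"
  proof -
    have "(\<Sum>s\<in>D. of_bool (w = v \<and> s = v) :: bit) = (if w = v then 1 else 0)" for w
    proof (cases "w = v")
      case True
      then show ?thesis using finCD D(2) by (simp add: of_bool_def sum.delta)
    qed simp
    then show ?thesis using finCD C(2) by (simp add: sum.delta)
  qed
  finally show False by simp
qed

lemma vertex_class_partition:
  assumes "wf_graph G"
  shows "(\<Union>i. vertex_class G i) = verts G"
    and "i \<noteq> j \<Longrightarrow> vertex_class G i \<inter> vertex_class G j = {}"
proof -
  show "(\<Union>i. vertex_class G i) = verts G"
  proof
    show "(\<Union>i. vertex_class G i) \<subseteq> verts G"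
    proof
      fix v assume "v \<in> (\<Union>i. vertex_class G i)"
      then obtain i where "v \<in> vertex_class G i" by blast
      then show "v \<in> verts G" by (cases i) auto
    qed
    show "verts G \<subseteq> (\<Union>i. vertex_class G i)"
    proof
      fix v assume v: "v \<in> verts G"
      have "v \<in> vertex_class G Coloop_both \<or> v \<in> vertex_class G Coloop_unlooped_only \<or>
            v \<in> vertex_class G Coloop_looped_only"
        using coloop_remove_loops_or_with_loop[of G v] v assms by (auto simp: wf_graph_def)
      then show "v \<in> (\<Union>i. vertex_class G i)" by blast
    qed
  qed
  show "vertex_class G i \<inter> vertex_class G j = {}" if "i \<noteq> j"
    using that by (cases i; cases j) auto
qed

end

theory Submission
  imports Defs
begin

text \<open>
  Two pairs of very small graphs suffice.

  The class of a vertex \<open>v\<close> only looks at \<open>G(v)\<close> and \<open>G(v,\<ell>)\<close>, neither of which remembers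
  whether \<open>v\<close> was looped in \<open>G\<close>. On a one-vertex graph this makes the tripartition blind to
  the loop, whereas the matroid sees it: the matrix is \<open>(0)\<close> without the loop, so the vertex is
  a circuit, and \<open>(1)\<close> with it, so there is no circuit at all.

  Conversely, all nonsingular matrices of a given size have the same adjacency matroid, the
  free one. Two isolated looped vertices and a single edge \<open>K\<^sub>2\<close> give such matrices of size
  two. In \<open>K\<^sub>2\<close> the row of each vertex is the unit vector of the other one, which forces a
  vertex to be a coloop whatever its own loop status (\<open>coloop_if_unit_row\<close>), so it is in
  the first class. An isolated vertex becomes a circuit once its loop is removed
  (\<open>singleton_circuit_if_zero_column\<close>), so it is not.
\<close>

text \<open>
  The columns of a circuit sum to zero, but those of a circuit through \<open>v\<close> would sum to
  \<open>1\<close> in row \<open>w\<close>. With \<open>w \<noteq> v\<close> the hypothesis does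
  not involve the diagonal entry at \<open>v\<close>, so it survives adding or removing a loop there.
\<close>

lemma coloop_if_unit_row:
  assumes "finite (verts G)" "v \<in> verts G" "w \<in> verts G"
    and row: "\<And>s. s \<in> verts G \<Longrightarrow> adj_matrix G w s = of_bool (s = v)"
  shows "coloop (adjacency_matroid G) v"
  unfolding coloop_def
proof (intro conjI ballI notI)
  show "v \<in> ground (adjacency_matroid G)"
    using assms(2) by (simp add: adjacency_matroid_def)
next
  fix C assume C: "C \<in> circuits (adjacency_matroid G)" and "v \<in> C"
  have sub: "C \<subseteq> verts G" using C by (simp add: adjacency_matroid_def)
  then have "finite C" using assms(1) finite_subset by blast
  have "(\<Sum>s\<in>C. adj_matrix G w s) = (\<Sum>s\<in>C. if s = v then 1 else 0)"
    using row sub by (intro sum.cong) auto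
  also have "\<dots> = 1" using \<open>finite C\<close> \<open>v \<in> C\<close> by simp
  finally show False
    using circuit_columns_sum[OF assms(1) C assms(3)] by simp
qed

lemma singleton_circuit_if_zero_column:
  assumes "v \<in> verts G" and "\<And>w. w \<in> verts G \<Longrightarrow> adj_matrix G w v = 0"
  shows "{v} \<in> circuits (adjacency_matroid G)"
proof -
  have "columns_dependent G {v}"
    using assms(2) by (subst columns_dependent_iff) auto
  moreover have "\<not> (T \<subset> {v} \<and> T \<noteq> {})" for T by blast
  ultimately show ?thesis
    using assms(1) by (auto simp: adjacency_matroid_def)
qed

lemma circuits_empty_if_all_coloops:
  assumes "\<And>v. v \<in> verts G \<Longrightarrow> coloop (adjacency_matroid G) v"
  shows "circuits (adjacency_matroid G) = {}"
proof (rule equals0I)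
  fix C assume C: "C \<in> circuits (adjacency_matroid G)"
  then obtain v where "v \<in> C" "v \<in> verts G"
    by (auto simp: adjacency_matroid_def)
  then show False using assms C by (auto simp: coloop_def)
qed

lemma vertex_class_subset_verts: "vertex_class G i \<subseteq> verts G"
  by (cases i) auto

lemma loop_irrelevant_to_own_class:
  "v \<in> vertex_class (with_loop G v) i \<longleftrightarrow> v \<in> vertex_class G i"
proof -
  have "remove_loops (with_loop G v) v = remove_loops G v"
    by (simp add: with_loop_def remove_loops_def filter_filter_mset)
  then have "with_loop (with_loop G v) v = with_loop G v"
    by (simp add: with_loop_def)
  with \<open>remove_loops (with_loop G v) v = remove_loops G v\<close> show ?thesis
    by (cases i) (simp_all add: loop_variants_simps)
qed

definition one_vertex :: "nat graph" where
  "one_vertex = \<lparr>verts = {0}, edges = {#}\<rparr>"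

definition two_isolated_loops :: "nat graph" where
  "two_isolated_loops = \<lparr>verts = {0, 1}, edges = {#Upair 0 0, Upair 1 1#}\<rparr>"

definition K2 :: "nat graph" where
  "K2 = \<lparr>verts = {0, 1}, edges = {#Upair 0 1#}\<rparr>"

lemma wf_examples:
  "wf_graph one_vertex" "wf_graph (with_loop one_vertex 0)"
  "wf_graph two_isolated_loops" "wf_graph K2"
  by (simp_all add: wf_graph_def one_vertex_def with_loop_def remove_loops_def
      two_isolated_loops_def K2_def)

lemma adj_matrix_examples:
  "adj_matrix one_vertex x y = 0"
  "adj_matrix two_isolated_loops x y = of_bool (x = y \<and> x \<in> {0, 1})"
  "adj_matrix K2 x y = of_bool ({x, y} = {0, 1})"
  by (auto simp: adj_matrix_def looped_def adjacent_def one_vertex_def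
      two_isolated_loops_def K2_def doubleton_eq_iff)

lemma verts_examples:
  "verts one_vertex = {0}" "verts two_isolated_loops = {0, 1}" "verts K2 = {0, 1}"
  by (simp_all add: one_vertex_def two_isolated_loops_def K2_def)

lemma one_vertex_tripartition_ignores_loop:
  "tripartition_equivalent one_vertex (with_loop one_vertex 0)"
proof -
  have "vertex_class one_vertex i = vertex_class (with_loop one_vertex 0) i" for i
    using vertex_class_subset_verts[of one_vertex i]
      vertex_class_subset_verts[of "with_loop one_vertex 0" i]
      loop_irrelevant_to_own_class[of 0 one_vertex i]
    by (auto simp: loop_variants_simps verts_examples)
  then show ?thesis
    unfolding tripartition_equivalent_def
    by (intro exI[of _ id]) (simp add: loop_variants_simps)
qed

lemma one_vertex_matroid_sees_loop:
  "\<not> matroid_isomorphic (adjacency_matroid one_vertex)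
      (adjacency_matroid (with_loop one_vertex 0))"
proof -
  have "circuits (adjacency_matroid (with_loop one_vertex 0)) = {}"
    by (rule circuits_empty_if_all_coloops, rule coloop_if_unit_row[where w = 0])
      (auto simp: loop_variants_simps verts_examples)
  moreover have "{0} \<in> circuits (adjacency_matroid one_vertex)"
    by (rule singleton_circuit_if_zero_column) (auto simp: adj_matrix_examples verts_examples)
  moreover have "{0} \<subseteq> ground (adjacency_matroid one_vertex)"
    by (simp add: adjacency_matroid_def verts_examples)
  ultimately show ?thesis
    unfolding matroid_isomorphic_def by blast
qed

lemma two_free_matroids_isomorphic:
  "matroid_isomorphic (adjacency_matroid two_isolated_loops) (adjacency_matroid K2)"
proof -
  have "coloop (adjacency_matroid two_isolated_loops) v" if "v \<in> {0, 1}" for v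
    by (rule coloop_if_unit_row[where w = v])
      (use that in \<open>auto simp: adj_matrix_examples verts_examples\<close>)
  then have "circuits (adjacency_matroid two_isolated_loops) = {}"
    by (intro circuits_empty_if_all_coloops) (simp add: verts_examples)
  moreover
  have "coloop (adjacency_matroid K2) v" if "v \<in> {0, 1}" for v
    \<comment> \<open>The witness \<open>1 - v\<close> is the other end of the edge.\<close>
    by (rule coloop_if_unit_row[where w = "1 - v"])
      (use that in \<open>auto simp: adj_matrix_examples verts_examples doubleton_eq_iff\<close>)
  then have "circuits (adjacency_matroid K2) = {}"
    by (intro circuits_empty_if_all_coloops) (simp add: verts_examples)
  moreover have "ground (adjacency_matroid two_isolated_loops) = ground (adjacency_matroid K2)"
    by (simp add: adjacency_matroid_def verts_examples)
  ultimately show ?thesis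
    unfolding matroid_isomorphic_def by (intro exI[of _ id]) simp
qed

lemma two_isolated_loops_no_Coloop_both:
  "vertex_class two_isolated_loops Coloop_both = {}"
proof -
  have "{v} \<in> circuits (adjacency_matroid (remove_loops two_isolated_loops v))"
    if "v \<in> {0, 1}" for v
    by (rule singleton_circuit_if_zero_column)
      (use that in \<open>auto simp: loop_variants_simps adj_matrix_examples verts_examples\<close>)
  then show ?thesis
    by (auto simp: coloop_def verts_examples)
qed

lemma K2_has_Coloop_both: "0 \<in> vertex_class K2 Coloop_both"
proof -
  have "coloop (adjacency_matroid (remove_loops K2 0)) 0"
    by (rule coloop_if_unit_row[where w = 1])
      (auto simp: loop_variants_simps adj_matrix_examples verts_examples doubleton_eq_iff)
  moreover have "coloop (adjacency_matroid (with_loop K2 0)) 0"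
    by (rule coloop_if_unit_row[where w = 1])
      (auto simp: loop_variants_simps adj_matrix_examples verts_examples doubleton_eq_iff)
  ultimately show ?thesis by (simp add: verts_examples)
qed

lemma two_free_tripartitions_inequivalent:
  "\<not> tripartition_equivalent two_isolated_loops K2"
  unfolding tripartition_equivalent_def
  using two_isolated_loops_no_Coloop_both K2_has_Coloop_both
  by (metis empty_iff image_empty)

theorem theorem24:
  shows "(\<exists>(G :: nat graph) (H :: nat graph). wf_graph G \<and> wf_graph H \<and>
            matroid_isomorphic (adjacency_matroid G) (adjacency_matroid H) \<and>
            \<not> tripartition_equivalent G H) \<and>
         (\<exists>(G :: nat graph) (H :: nat graph). wf_graph G \<and> wf_graph H \<and>
            \<not> matroid_isomorphic (adjacency_matroid G) (adjacency_matroid H) \<and>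
            tripartition_equivalent G H)"
  using wf_examples two_free_matroids_isomorphic two_free_tripartitions_inequivalent
    one_vertex_matroid_sees_loop one_vertex_tripartition_ignores_loop
  by blast

end
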